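(* Assume $d \ge 2$, $f \in \mathcal{R}_d$ and $\mathrm{ann}_R(f)_1 = 0$. Let $\mathrm{Coid}(M_f)$ be the set of all complete sets $\{E_1,\dots,E_n\}$ (with $n\ge1$ arbitrary) of orthogonal idempotents in $M_f$, and let $$\mathrm{Reg}(f)=\bigl\{\{g_1,\dots,g_n\} : f=g_1+\dots+g_n \text{ is a regular splitting of } f\bigr\}.$$ Then the map $\{E_i\}_{i=1}^n\mapsto\{g_i=\gamma_f(E_i)\}_{i=1}^n$ defines a bijection $\mathrm{Coid}(M_f)\to\mathrm{Reg}(f)$. In particular, when $d\ge3$ there is a unique maximal regular splitting of $f$, i.e. there is a unique regular splitting of maximal length, and every other regular splitting of $f$ is obtained from it by grouping some of its summands.
   Context: $K$ is a field, $r\ge 1$, $R=K[\partial_1,\dots,\partial_r]$ is a polynomial ring with the standard grading, and $\mathcal{R}=K[x_1,\dots,x_r]^{DP}=\bigoplus_{d\ge0}\mathcal{R}_d$ is the divided power ring: $\mathcal{R}_d$ has $K$-basis $x^{(\alpha)}=\prod_i x_i^{(\alpha_i)}$, $|\alpha|=d$, with multiplication generated by $x_i^{(a)}x_i^{(b)}=\binom{a+b}{a}x_i^{(a+b)}$. $R$ acts on $\mathcal{R}$ by $\partial^\beta(x^{(\alpha)})=x^{(\alpha-\beta)}$ (zero if some $\alpha_i<\beta_i$). $\mathrm{ann}_R(f)=\{D\in R:Df=0\}$, with degree $e$ part $\mathrm{ann}_R(f)_e$; $R_e(f)=\{Df:D\in R_e\}$. Put $\partial=[\partial_1,\dots,\partial_r]^T$,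 acting entrywise. For $A\in\mathrm{Mat}_K(r,r)$, $I_2(\partial\;A\partial)$ is the ideal of $R$ generated by the $2\times2$ minors of the $r\times2$ matrix with columns $\partial$ and $A\partial$, and $$M_f=\{A\in\mathrm{Mat}_K(r,r): I_2(\partial\;A\partial)\subseteq\mathrm{ann}_R(f)\}.$$ For $d>0$, $\gamma_f:M_f\to\mathcal{R}_d$ sends $A$ to the unique $g\in\mathcal{R}_d$ with $\partial g=A\,\partial f$. A set $\{E_1,\dots,E_n\}$ of matrices is a complete set of orthogonal idempotents if $E_i^2=E_i\neq0$ for all $i$, $E_iE_j=0$ for $i\ne j$, and $\sum_iE_i=I$. A regular splitting of $f\in\mathcal{R}_d$ of length $n$ is an expression $f=g_1+\dots+g_n$ with nonzero $g_i\in\mathcal{R}_d$ such that $R_{d-1}(g_i)\cap\sum_{j\ne i}R_{d-1}(g_j)=0$ in $\mathcal{R}_1$ for all $i$. *)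

theory Defs
  imports
    "HOL-Analysis.Determinants"
    "HOL-Library.Poly_Mapping"
    "HOL-Library.Multiset"
    "HOL-Library.Set_Algebras"
begin

text \<open>
  The variables are indexed by the finite type \<open>'n\<close>, so \<open>r = CARD('n) \<ge> 1\<close>.
  Both the polynomial ring \<open>R\<close> and the divided power ring are represented by finitely supported
  families of coefficients indexed by exponents: \<open>single \<alpha> c\<close> stands for \<open>c \<partial>^\<alpha>\<close> in the
  former and for \<open>c x^(\<alpha>)\<close> in the latter.
  The type-class multiplication of this type is the multiplication of \<open>R\<close> and is used only there;
  of the divided power ring we need just the graded vector space and the action of \<open>R\<close>.
\<close>

type_synonym ('a, 'n) dpoly = "('n \<Rightarrow>\<^sub>0 nat) \<Rightarrow>\<^sub>0 'a"
type_synonym ('a, 'n) divpow = "('n \<Rightarrow>\<^sub>0 nat) \<Rightarrow>\<^sub>0 'a"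

definition homog :: "nat \<Rightarrow> (('n::finite \<Rightarrow>\<^sub>0 nat) \<Rightarrow>\<^sub>0 'a::zero) set" where
  "homog d = {p. \<forall>\<alpha>\<in>Poly_Mapping.keys p. (\<Sum>i\<in>UNIV. Poly_Mapping.lookup \<alpha> i) = d}"

definition smul :: "'a::mult_zero \<Rightarrow> ('m \<Rightarrow>\<^sub>0 'a) \<Rightarrow> ('m \<Rightarrow>\<^sub>0 'a)" where
  "smul c p = Poly_Mapping.map ((*) c) p"

text \<open>The product of a matrix of scalars with a column of elements of \<open>R\<close> or of the divided power ring.\<close>

definition smul_mat_vec :: "'a::semiring_0 ^ 'n ^ 'n \<Rightarrow> ('m \<Rightarrow>\<^sub>0 'a) ^ 'n \<Rightarrow> ('m \<Rightarrow>\<^sub>0 'a) ^ 'n" where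
  "smul_mat_vec A v = (\<chi> i. \<Sum>j\<in>UNIV. smul (A $ i $ j) (v $ j))"

definition contract :: "('a::field, 'n) dpoly \<Rightarrow> ('a, 'n) divpow \<Rightarrow> ('a, 'n) divpow" where
  "contract D f =
     (\<Sum>\<beta>\<in>Poly_Mapping.keys D. \<Sum>\<alpha>\<in>Poly_Mapping.keys f.
        if \<forall>i. Poly_Mapping.lookup \<beta> i \<le> Poly_Mapping.lookup \<alpha> i
        then Poly_Mapping.single (\<alpha> - \<beta>) (Poly_Mapping.lookup D \<beta> * Poly_Mapping.lookup f \<alpha>)
        else 0)"

definition ann :: "('a::field, 'n) divpow \<Rightarrow> ('a, 'n) dpoly set" where
  "ann f = {D. contract D f = 0}"

definition deriv_space :: "nat \<Rightarrow> ('a::field, 'n::finite) divpow \<Rightarrow> ('a, 'n) divpow set" where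
  "deriv_space e f = {contract D f | D. D \<in> homog e}"

definition partials :: "('a::field, 'n) dpoly ^ 'n" where
  "partials = (\<chi> i. Poly_Mapping.single (Poly_Mapping.single i 1) 1)"

definition grad :: "('a::field, 'n) divpow \<Rightarrow> ('a, 'n) divpow ^ 'n" where
  "grad f = (\<chi> i. contract (partials $ i) f)"

lemma module_times: "module ((*) :: 'b::comm_ring_1 \<Rightarrow> 'b \<Rightarrow> 'b)"
  by unfold_locales (simp_all add: algebra_simps)

text \<open>
  By \<open>module_times\<close>, the ideal generated by a set is its span when the ring is viewed as a
  module over itself. The injection \<open>s\<close> picks the two rows of a minor; listing them in both
  orders only repeats each minor up to sign.
\<close>

definition I2 :: "'b::comm_ring_1 ^ 2 ^ 'n \<Rightarrow> 'b set" where
  "I2 M = module.span (*) {det (\<chi> k. M $ s k) | s :: 2 \<Rightarrow> 'n. inj s}"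

definition Mf :: "('a::field, 'n::finite) divpow \<Rightarrow> ('a ^ 'n ^ 'n) set" where
  "Mf f = {A. I2 (\<chi> i. vector [partials $ i, smul_mat_vec A partials $ i]) \<subseteq> ann f}"

definition gamma :: "nat \<Rightarrow> ('a::field, 'n::finite) divpow \<Rightarrow> 'a ^ 'n ^ 'n \<Rightarrow> ('a, 'n) divpow" where
  "gamma d f A = (THE g. g \<in> homog d \<and> grad g = smul_mat_vec A (grad f))"

definition complete_orth_idems :: "('a::field ^ 'n ^ 'n) list \<Rightarrow> bool" where
  "complete_orth_idems Es \<longleftrightarrow>
     Es \<noteq> [] \<and>
     (\<forall>i<length Es. Es ! i ** Es ! i = Es ! i \<and> Es ! i \<noteq> 0) \<and>
     (\<forall>i<length Es. \<forall>j<length Es. i \<noteq> j \<longrightarrow> Es ! i ** Es ! j = 0) \<and>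
     sum_list Es = mat 1"

definition Coid :: "('a::field ^ 'n ^ 'n) set \<Rightarrow> ('a ^ 'n ^ 'n) set set" where
  "Coid M = {set Es | Es. complete_orth_idems Es \<and> set Es \<subseteq> M}"

text \<open>The outer sum is the sum of subsets of an additive group, with empty sum \<open>{0}\<close>.\<close>

definition regular_splitting ::
    "nat \<Rightarrow> ('a::field, 'n::finite) divpow \<Rightarrow> ('a, 'n) divpow list \<Rightarrow> bool" where
  "regular_splitting d f gs \<longleftrightarrow>
     gs \<noteq> [] \<and>
     f = sum_list gs \<and>
     (\<forall>i<length gs. gs ! i \<in> homog d \<and> gs ! i \<noteq> 0 \<and>
        deriv_space (d - 1) (gs ! i) \<inter>
          (\<Sum>j\<in>{..<length gs} - {i}. deriv_space (d - 1) (gs ! j)) = {0})"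

definition Reg :: "nat \<Rightarrow> ('a::field, 'n::finite) divpow \<Rightarrow> ('a, 'n) divpow set set" where
  "Reg d f = {set gs | gs. regular_splitting d f gs}"

text \<open>Summand \<open>i\<close> of \<open>gs\<close> is put into the group \<open>\<sigma> i\<close>; the groups are nonempty.\<close>

definition grouping_of :: "'b::comm_monoid_add list \<Rightarrow> 'b list \<Rightarrow> bool" where
  "grouping_of gs hs \<longleftrightarrow>
     (\<exists>\<sigma>. \<sigma> ` {..<length gs} = {..<length hs} \<and>
          (\<forall>j<length hs. hs ! j = (\<Sum>i | i < length gs \<and> \<sigma> i = j. gs ! i)))"

end

theory Submission imports Defs begin

text \<open>
  Let \<open>v\<^sub>f(\<alpha>)\<close> be the vector of coefficients of \<open>x^(\<alpha>)\<close> in the column \<open>\<partial>f\<close> (called \<open>jet f \<alpha>\<close> below), so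
  that \<open>\<partial>g = A\<partial>f\<close> means \<open>v\<^sub>g(\<alpha>) = A v\<^sub>f(\<alpha>)\<close> for all \<open>\<alpha>\<close>.  That \<open>A\<close> lies in \<open>Mf f\<close> is the integrability
  condition \<open>\<partial>\<^sub>i (A\<partial>f)\<^sub>j = \<partial>\<^sub>j (A\<partial>f)\<^sub>i\<close> (\<open>Mf_iff\<close>), hence it is equivalent to the existence of \<open>g\<close> with
  \<open>\<partial>g = A\<partial>f\<close> (\<open>Mf_if_grad_eq\<close>, \<open>ex_grad_eq_if_Mf\<close>).  The assumption that no linear operator
  annihilates \<open>f\<close> says that only the zero matrix kills all the vectors \<open>v\<^sub>f(\<alpha>)\<close>
  (\<open>eq_0_if_annihilates_jets\<close>); in particular \<open>gamma\<close> is injective.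

  In coordinates, the space of linear forms \<open>deriv_space (d - 1) g\<close> is the span of the vectors
  \<open>v\<^sub>g(\<alpha>)\<close> (\<open>jet_image_deriv_space\<close>).  If \<open>g\<^sub>i\<close> is the image of the idempotent \<open>E\<^sub>i\<close>, this span lies in the
  image of \<open>E\<^sub>i\<close>, and the images of orthogonal idempotents are independent; this gives a regular
  splitting (\<open>regular_splitting_if_idems\<close>).  Conversely, the spans belonging to the summands of a
  regular splitting are independent, and they span the whole space because of the assumption on
  \<open>f\<close>.  The projections \<open>E\<^sub>i\<close> of this direct sum satisfy \<open>v\<^sub>g(\<alpha>) = E\<^sub>i v\<^sub>f(\<alpha>)\<close> for \<open>g = g\<^sub>i\<close>, so they lie in
  \<open>Mf f\<close> and are mapped to the \<open>g\<^sub>i\<close> (\<open>idems_if_regular_splitting\<close>).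

  In degree at least three, integrability allows two matrices in \<open>Mf f\<close> to be moved to different
  indices of the array of third partial derivatives of \<open>f\<close>, where they commute; it follows that
  \<open>Mf f\<close> is a commutative algebra (\<open>Mf_commute\<close>, \<open>Mf_mult\<close>).  Complete sets of orthogonal idempotents
  have bounded size, so one of maximal size exists.  If \<open>E\<close> belongs to it and \<open>F\<close> is any idempotent
  of \<open>Mf f\<close>, then \<open>EF\<close> is \<open>0\<close> or \<open>E\<close>, as otherwise \<open>E\<close> could be replaced by the two idempotents \<open>EF\<close> and
  \<open>E - EF\<close>.  Thus each member of any other complete set is the sum of those \<open>E\<close> that it does not
  kill, which is the asserted grouping (\<open>grouping_of_idems\<close>), and two sets of maximal size coincide.
\<close>

section \<open>Coefficients of contractions\<close>

lemma lookup_smul: "Poly_Mapping.lookup (smul c p) m = c * Poly_Mapping.lookup p m"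
  by (simp add: smul_def Poly_Mapping.map.rep_eq when_def)

lemma smul_single: "smul c (Poly_Mapping.single m a) = Poly_Mapping.single m (c * a)"
  by (rule poly_mapping_eqI) (simp add: lookup_smul lookup_single when_def)

lemma le_exponent_iff:
  fixes \<alpha> \<beta> :: "'n \<Rightarrow>\<^sub>0 nat"
  shows "(\<forall>i. Poly_Mapping.lookup \<beta> i \<le> Poly_Mapping.lookup \<alpha> i) \<longleftrightarrow> (\<exists>\<gamma>. \<alpha> = \<gamma> + \<beta>)"
proof
  assume "\<forall>i. Poly_Mapping.lookup \<beta> i \<le> Poly_Mapping.lookup \<alpha> i"
  then have "\<alpha> = (\<alpha> - \<beta>) + \<beta>"
    by (intro poly_mapping_eqI) (simp add: lookup_add lookup_minus)
  then show "\<exists>\<gamma>. \<alpha> = \<gamma> + \<beta>" by blast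
qed (auto simp: lookup_add)

lemma lookup_contract:
  fixes f :: "('a::field, 'n) divpow"
  shows "Poly_Mapping.lookup (contract D f) \<alpha> =
    (\<Sum>\<beta>\<in>Poly_Mapping.keys D. Poly_Mapping.lookup D \<beta> * Poly_Mapping.lookup f (\<alpha> + \<beta>))"
proof -
  have "(\<Sum>\<kappa>\<in>Poly_Mapping.keys f. Poly_Mapping.lookup
          (if \<forall>i. Poly_Mapping.lookup \<beta> i \<le> Poly_Mapping.lookup \<kappa> i
           then Poly_Mapping.single (\<kappa> - \<beta>) (Poly_Mapping.lookup D \<beta> * Poly_Mapping.lookup f \<kappa>)
           else 0) \<alpha>) =
        Poly_Mapping.lookup D \<beta> * Poly_Mapping.lookup f (\<alpha> + \<beta>)" for \<beta>
  proof -
    have "Poly_Mapping.lookup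
          (if \<forall>i. Poly_Mapping.lookup \<beta> i \<le> Poly_Mapping.lookup \<kappa> i
           then Poly_Mapping.single (\<kappa> - \<beta>) (Poly_Mapping.lookup D \<beta> * Poly_Mapping.lookup f \<kappa>)
           else 0) \<alpha> =
          (if \<kappa> = \<alpha> + \<beta> then Poly_Mapping.lookup D \<beta> * Poly_Mapping.lookup f (\<alpha> + \<beta>) else 0)" for \<kappa>
      unfolding le_exponent_iff by (auto simp: lookup_single)
    then show ?thesis
      by (simp add: sum.delta in_keys_iff)
  qed
  then show ?thesis
    by (simp add: contract_def lookup_sum)
qed

lemma lookup_contract_superset:
  fixes f :: "('a::field, 'n) divpow"
  assumes "finite B" "Poly_Mapping.keys D \<subseteq> B"
  shows "Poly_Mapping.lookup (contract D f) \<alpha> =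
    (\<Sum>\<beta>\<in>B. Poly_Mapping.lookup D \<beta> * Poly_Mapping.lookup f (\<alpha> + \<beta>))"
  unfolding lookup_contract using assms
  by (intro sum.mono_neutral_left) (auto simp: in_keys_iff)

lemma lookup_contract_single:
  fixes f :: "('a::field, 'n) divpow"
  shows "Poly_Mapping.lookup (contract (Poly_Mapping.single \<beta> c) f) \<alpha> =
    c * Poly_Mapping.lookup f (\<alpha> + \<beta>)"
  by (subst lookup_contract_superset[of "{\<beta>}"]) (auto simp: keys_single)

lemma contract_add: "contract (D + E) f = contract D f + contract E f"
proof (rule poly_mapping_eqI)
  fix \<alpha>
  let ?B = "Poly_Mapping.keys D \<union> Poly_Mapping.keys E"
  show "Poly_Mapping.lookup (contract (D + E) f) \<alpha> =
      Poly_Mapping.lookup (contract D f + contract E f) \<alpha>"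
    using keys_add[of D E]
    by (simp add: lookup_contract_superset[of ?B] lookup_add distrib_right sum.distrib)
qed

lemma contract_zero [simp]: "contract 0 f = 0" "contract D 0 = 0"
  by (rule poly_mapping_eqI, simp add: lookup_contract)+

lemma contract_add_right: "contract D (f + g) = contract D f + contract D g"
  by (rule poly_mapping_eqI)
    (simp add: lookup_contract lookup_add distrib_left sum.distrib)

lemma contract_sum_left: "contract (\<Sum>i\<in>I. D i) f = (\<Sum>i\<in>I. contract (D i) f)"
  by (induction I rule: infinite_finite_induct) (auto simp: contract_add)

lemma contract_sum_right: "contract D (\<Sum>i\<in>I. f i) = (\<Sum>i\<in>I. contract D (f i))"
  by (induction I rule: infinite_finite_induct) (auto simp: contract_add_right)

lemma sum_single_lookup:
  "p = (\<Sum>\<beta>\<in>Poly_Mapping.keys p. Poly_Mapping.single \<beta> (Poly_Mapping.lookup p \<beta>))"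
  by (rule poly_mapping_eqI) (auto simp: lookup_sum lookup_single when_def sum.delta' sum.delta in_keys_iff)

lemma contract_mult: "contract (D * E) f = contract D (contract E f)"
proof -
  have monom: "contract (Poly_Mapping.single \<beta> b * Poly_Mapping.single \<gamma> c) f =
      contract (Poly_Mapping.single \<beta> b) (contract (Poly_Mapping.single \<gamma> c) f)" for \<beta> \<gamma> b c
    by (rule poly_mapping_eqI) (simp add: mult_single lookup_contract_single ac_simps)
  show ?thesis
    by (subst (1 2) sum_single_lookup[of D], subst (1 2) sum_single_lookup[of E])
      (simp add: sum_product contract_sum_left contract_sum_right monom
        sum.swap[of _ "Poly_Mapping.keys E"])
qed

text \<open>
  Since \<open>(DE)f = D(Ef)\<close>, the annihilator is an ideal; it contains \<open>I2 M\<close> as soon as it contains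
  the minors themselves.
\<close>

lemma span_subset_ann_iff: "module.span (*) X \<subseteq> ann f \<longleftrightarrow> X \<subseteq> ann f"
proof
  assume "module.span (*) X \<subseteq> ann f"
  then show "X \<subseteq> ann f"
    using module.span_superset[OF module_times] by blast
next
  assume X: "X \<subseteq> ann f"
  have "module.subspace (*) (ann f)"
    by (auto simp: module.subspace_def[OF module_times] ann_def contract_add contract_mult)
  then show "module.span (*) X \<subseteq> ann f"
    using X module.span_minimal[OF module_times] by blast
qed

section \<open>The matrices in \<open>Mf f\<close>\<close>

text \<open>
  This is the coefficient of \<open>x^(\<alpha>)\<close> in the column \<open>\<partial>f\<close>.  In these terms \<open>\<partial>g = A \<partial>f\<close> becomes
  \<open>jet g \<alpha> = A *v jet f \<alpha>\<close> for all \<open>\<alpha>\<close>, a statement about vectors over the field.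
\<close>

definition jet :: "('a::field, 'n::finite) divpow \<Rightarrow> ('n \<Rightarrow>\<^sub>0 nat) \<Rightarrow> 'a ^ 'n" where
  "jet f \<alpha> = (\<chi> k. Poly_Mapping.lookup f (\<alpha> + Poly_Mapping.single k 1))"

lemma jet_nth: "jet f \<alpha> $ k = Poly_Mapping.lookup f (\<alpha> + Poly_Mapping.single k 1)"
  by (simp add: jet_def)

lemma lookup_contract_partials:
  "Poly_Mapping.lookup (contract (partials $ i) g) \<alpha> =
    Poly_Mapping.lookup g (\<alpha> + Poly_Mapping.single i 1)"
  by (simp add: partials_def lookup_contract_single)

lemma lookup_grad: "Poly_Mapping.lookup (grad f $ k) \<alpha> = jet f \<alpha> $ k"
  by (simp add: grad_def partials_def lookup_contract_single jet_nth)

lemma grad_eq_smul_mat_vec_iff: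
  "grad g = smul_mat_vec A (grad f) \<longleftrightarrow> (\<forall>\<alpha>. jet g \<alpha> = A *v jet f \<alpha>)"
proof -
  have "grad g = smul_mat_vec A (grad f) \<longleftrightarrow>
     (\<forall>k \<alpha>. Poly_Mapping.lookup (grad g $ k) \<alpha> = Poly_Mapping.lookup (smul_mat_vec A (grad f) $ k) \<alpha>)"
    by (auto simp: vec_eq_iff intro: poly_mapping_eqI)
  also have "\<dots> \<longleftrightarrow> (\<forall>\<alpha>. jet g \<alpha> = A *v jet f \<alpha>)"
    by (auto simp: lookup_grad smul_mat_vec_def lookup_sum lookup_smul vec_eq_iff
        matrix_vector_mult_def)
  finally show ?thesis .
qed

lemma lookup_contract_row:
  fixes f :: "('a::field, 'n::finite) divpow"
  shows "Poly_Mapping.lookup (contract (smul_mat_vec A partials $ i) f) \<alpha> = (A *v jet f \<alpha>) $ i"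
  by (simp add: smul_mat_vec_def contract_sum_left lookup_sum partials_def smul_single
      lookup_contract_single jet_nth matrix_vector_mult_def)

text \<open>
  The minor with rows \<open>i\<close> and \<open>j\<close> is \<open>\<partial>\<^sub>i (A\<partial>)\<^sub>j - \<partial>\<^sub>j (A\<partial>)\<^sub>i\<close>, so \<open>A \<in> Mf f\<close> is the integrability
  condition \<open>\<partial>\<^sub>i (A\<partial>f)\<^sub>j = \<partial>\<^sub>j (A\<partial>f)\<^sub>i\<close> on the column \<open>A\<partial>f\<close>, written out in coefficients.
\<close>

lemma Mf_iff:
  fixes f :: "('a::field, 'n::finite) divpow"
  shows "A \<in> Mf f \<longleftrightarrow> (\<forall>\<alpha> i j. (A *v jet f (\<alpha> + Poly_Mapping.single i 1)) $ j =
                              (A *v jet f (\<alpha> + Poly_Mapping.single j 1)) $ i)"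
    (is "_ \<longleftrightarrow> (\<forall>\<alpha> i j. ?S \<alpha> i j = ?S \<alpha> j i)")
proof -
  define m where "m i j = partials $ i * smul_mat_vec A partials $ j
    - smul_mat_vec A partials $ i * partials $ j" for i j
  have det: "det (\<chi> k. (\<chi> i. (vector [partials $ i, smul_mat_vec A partials $ i] :: ('a,'n) dpoly ^ 2)) $ s k) = m (s 1) (s 2)"
    for s :: "2 \<Rightarrow> 'n"
    by (simp add: det_2 m_def)
  have minors: "{m (s 1) (s 2) | s :: 2 \<Rightarrow> 'n. inj s} = {m i j | i j. i \<noteq> j}"
  proof (intro equalityI subsetI)
    fix D assume "D \<in> {m i j | i j. i \<noteq> j}"
    then obtain i j where D: "D = m i j" "i \<noteq> j" by blast
    have "inj (\<lambda>k::2. if k = 1 then i else j)"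
      using D(2) by (auto simp: inj_def) (metis exhaust_2)+
    then show "D \<in> {m (s 1) (s 2) | s :: 2 \<Rightarrow> 'n. inj s}"
      using D by (intro CollectI exI[of _ "\<lambda>k::2. if k = 1 then i else j"]) simp
  next
    fix D assume "D \<in> {m (s 1) (s 2) | s :: 2 \<Rightarrow> 'n. inj s}"
    then obtain s :: "2 \<Rightarrow> 'n" where "D = m (s 1) (s 2)" "inj s" by blast
    moreover from this have "s 1 \<noteq> s 2" by (simp add: inj_eq)
    ultimately show "D \<in> {m i j | i j. i \<noteq> j}" by blast
  qed
  have m: "contract (m i j) f = 0 \<longleftrightarrow> (\<forall>\<alpha>. ?S \<alpha> i j = ?S \<alpha> j i)" for i j
  proof -
    have "m i j + partials $ j * smul_mat_vec A partials $ i =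
        partials $ i * smul_mat_vec A partials $ j"
      by (simp add: m_def mult.commute)
    from arg_cong[OF this, of "\<lambda>D. contract D f"]
    have "Poly_Mapping.lookup (contract (m i j) f) \<alpha> + ?S \<alpha> j i = ?S \<alpha> i j" for \<alpha>
      by (auto dest!: arg_cong[where f="\<lambda>p. Poly_Mapping.lookup p \<alpha>"]
         simp: contract_add contract_mult lookup_add lookup_contract_partials lookup_contract_row)
    then show ?thesis
      by (metis add_0 add_cancel_left_left lookup_zero poly_mapping_eqI)
  qed
  have "A \<in> Mf f \<longleftrightarrow> (\<forall>i j. i \<noteq> j \<longrightarrow> contract (m i j) f = 0)"
    unfolding Mf_def I2_def mem_Collect_eq span_subset_ann_iff det minors
    by (auto simp: ann_def)
  then show ?thesis
    unfolding m by metis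
qed

text \<open>
  A column that is already a gradient satisfies the integrability condition, since partial
  derivatives commute.
\<close>

lemma Mf_if_grad_eq:
  assumes "\<And>\<alpha>. jet g \<alpha> = A *v jet f \<alpha>"
  shows "A \<in> Mf f"
  unfolding Mf_iff assms[symmetric] by (simp add: jet_nth ac_simps)

section \<open>Homogeneous elements and the map gamma\<close>

definition tdeg :: "('n::finite \<Rightarrow>\<^sub>0 nat) \<Rightarrow> nat" where
  "tdeg \<alpha> = (\<Sum>i\<in>UNIV. Poly_Mapping.lookup \<alpha> i)"

lemma tdeg_zero [simp]: "tdeg 0 = 0"
  by (simp add: tdeg_def)

lemma tdeg_add [simp]: "tdeg (\<alpha> + \<beta>) = tdeg \<alpha> + tdeg \<beta>"
  by (simp add: tdeg_def lookup_add sum.distrib)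

lemma tdeg_single [simp]: "tdeg (Poly_Mapping.single k m) = m"
  by (simp add: tdeg_def lookup_single when_def)

lemma tdeg_eq_0_iff [simp]: "tdeg \<alpha> = 0 \<longleftrightarrow> \<alpha> = 0"
  by (auto simp: tdeg_def intro: poly_mapping_eqI)

lemma exponent_decomp:
  assumes "Poly_Mapping.lookup \<alpha> i > 0"
  obtains \<beta> where "\<alpha> = \<beta> + Poly_Mapping.single i (1::nat)"
proof
  show "\<alpha> = (\<alpha> - Poly_Mapping.single i 1) + Poly_Mapping.single i 1"
    using assms by (intro poly_mapping_eqI) (auto simp: lookup_add lookup_minus lookup_single when_def)
qed

lemma exponent_cases:
  obtains "\<alpha> = 0" | \<beta> i where "\<alpha> = \<beta> + Poly_Mapping.single i (1::nat)"
proof (cases "\<alpha> = 0")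
  case False
  then obtain i where "Poly_Mapping.lookup \<alpha> i > 0"
    by (metis gr0I lookup_zero poly_mapping_eqI)
  then obtain \<beta> where "\<alpha> = \<beta> + Poly_Mapping.single i 1"
    by (rule exponent_decomp)
  then show ?thesis by (rule that(2))
qed (rule that(1))

lemma homog_iff: "p \<in> homog d \<longleftrightarrow> (\<forall>\<alpha>. Poly_Mapping.lookup p \<alpha> \<noteq> 0 \<longrightarrow> tdeg \<alpha> = d)"
  by (auto simp: homog_def tdeg_def in_keys_iff)

lemma zero_homog [simp]: "0 \<in> homog d"
  by (simp add: homog_iff)

lemma homog_add: "p \<in> homog d \<Longrightarrow> q \<in> homog d \<Longrightarrow> p + q \<in> homog d"
  by (auto simp: homog_iff lookup_add) (metis add.left_neutral)

lemma homog_sum: "(\<And>i. i \<in> I \<Longrightarrow> p i \<in> homog d) \<Longrightarrow> sum p I \<in> homog d"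
  by (induction I rule: infinite_finite_induct) (auto intro: homog_add)

lemma homog_smul: "p \<in> homog d \<Longrightarrow> smul c p \<in> homog d"
  unfolding homog_iff lookup_smul by (metis mult_zero_right)

lemma tdeg_if_jet_nonzero:
  assumes "f \<in> homog d" "jet f \<alpha> \<noteq> 0"
  shows "tdeg \<alpha> + 1 = d"
proof -
  obtain k where "Poly_Mapping.lookup f (\<alpha> + Poly_Mapping.single k 1) \<noteq> 0"
    using assms(2) by (auto simp: vec_eq_iff jet_nth)
  then have "tdeg (\<alpha> + Poly_Mapping.single k 1) = d"
    using assms(1) unfolding homog_iff by blast
  then show ?thesis by simp
qed

text \<open>
  Integration has no constants here: the only coefficient that the gradient does not see is the one
  of \<open>x^(0)\<close>, and it vanishes in positive degree.
\<close>

lemma homog_eqI: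
  assumes "f \<in> homog d" "g \<in> homog d" "d > 0" and jet: "\<And>\<alpha>. jet f \<alpha> = jet g \<alpha>"
  shows "f = g"
proof (rule poly_mapping_eqI)
  fix \<alpha>
  show "Poly_Mapping.lookup f \<alpha> = Poly_Mapping.lookup g \<alpha>"
  proof (cases \<alpha> rule: exponent_cases)
    case 1
    then show ?thesis
      using assms(1-3) by (auto simp: homog_iff dest!: spec[of _ 0])
  next
    case (2 \<beta> i)
    then show ?thesis
      using arg_cong[OF jet[of \<beta>], of "\<lambda>v. v $ i"] by (simp add: jet_nth)
  qed
qed

lemma jet_add: "jet (f + g) \<alpha> = jet f \<alpha> + jet g \<alpha>"
  by (simp add: vec_eq_iff jet_nth lookup_add)

lemma jet_zero [simp]: "jet 0 \<alpha> = 0"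
  by (simp add: vec_eq_iff jet_nth)

lemma jet_sum: "jet (\<Sum>i\<in>I. f i) \<alpha> = (\<Sum>i\<in>I. jet (f i) \<alpha>)"
  by (induction I rule: infinite_finite_induct) (auto simp: jet_add)

lemma jet_smul: "jet (smul c f) \<alpha> = c *s jet f \<alpha>"
  by (simp add: vec_eq_iff jet_nth lookup_smul)

lemma matrix_vector_mult_nonzeroD: "(A *v v) $ k \<noteq> 0 \<Longrightarrow> \<exists>l. v $ l \<noteq> 0"
  by (metis matrix_vector_mult_0_right vec_eq_iff zero_index)

text \<open>
  The coefficient of the primitive \<open>g\<close> at \<open>\<kappa>\<close> has to be the \<open>i\<close>-th entry of \<open>A\<partial>f\<close> at \<open>\<kappa> - e i\<close> for every \<open>i\<close>
  with \<open>\<kappa>\<^sub>i > 0\<close>.  One such \<open>i\<close> is chosen for each \<open>\<kappa>\<close>; integrability makes the value independent of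
  the choice.
\<close>

lemma ex_grad_eq_if_Mf:
  fixes f :: "('a::field, 'n::finite) divpow"
  assumes A: "A \<in> Mf f" and f: "f \<in> homog d"
  shows "\<exists>g\<in>homog d. \<forall>\<alpha>. jet g \<alpha> = A *v jet f \<alpha>"
proof -
  define e :: "'n \<Rightarrow> ('n \<Rightarrow>\<^sub>0 nat)" where "e k = Poly_Mapping.single k 1" for k
  define i where "i \<kappa> = (SOME k. Poly_Mapping.lookup \<kappa> k > 0)" for \<kappa> :: "'n \<Rightarrow>\<^sub>0 nat"
  define v where "v \<kappa> = (if \<kappa> = 0 then 0 else (A *v jet f (\<kappa> - e (i \<kappa>))) $ i \<kappa>)" for \<kappa>
  have v: "v (\<alpha> + e k) = (A *v jet f \<alpha>) $ k" for \<alpha> k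
  proof -
    define i0 where "i0 = i (\<alpha> + e k)"
    have "Poly_Mapping.lookup (\<alpha> + e k) k > 0"
      by (simp add: e_def lookup_add)
    then have pos: "Poly_Mapping.lookup (\<alpha> + e k) i0 > 0"
      unfolding i_def i0_def by (rule someI)
    then have "\<alpha> + e k \<noteq> 0" by auto
    then have v0: "v (\<alpha> + e k) = (A *v jet f (\<alpha> + e k - e i0)) $ i0"
      by (simp add: v_def i0_def)
    show ?thesis
    proof (cases "i0 = k")
      case True
      then show ?thesis using v0 by simp
    next
      case False
      then have "Poly_Mapping.lookup \<alpha> i0 > 0"
        using pos by (simp add: e_def lookup_add lookup_single)
      then obtain \<beta> where \<beta>: "\<alpha> = \<beta> + e i0"
        unfolding e_def by (rule exponent_decomp)
      then have "\<alpha> + e k = \<beta> + e k + e i0"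
        by (simp add: ac_simps)
      then have "v (\<alpha> + e k) = (A *v jet f (\<beta> + e k)) $ i0"
        using v0 by simp
      also have "\<dots> = (A *v jet f (\<beta> + e i0)) $ k"
        using A unfolding Mf_iff e_def by blast
      finally show ?thesis using \<beta> by simp
    qed
  qed
  have decomp: "\<exists>\<alpha> k l. \<kappa> = \<alpha> + e k \<and> Poly_Mapping.lookup f (\<alpha> + e l) \<noteq> 0" if nz: "v \<kappa> \<noteq> 0" for \<kappa>
  proof (cases \<kappa> rule: exponent_cases)
    case 1
    then show ?thesis using nz by (simp add: v_def)
  next
    case (2 \<alpha> k)
    then have "(A *v jet f \<alpha>) $ k \<noteq> 0"
      using v[of \<alpha> k] nz by (simp add: e_def)
    then obtain l where "jet f \<alpha> $ l \<noteq> 0"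
      using matrix_vector_mult_nonzeroD by blast
    then have "Poly_Mapping.lookup f (\<alpha> + e l) \<noteq> 0"
      by (simp add: jet_nth e_def)
    then show ?thesis
      using 2 unfolding e_def[symmetric] by blast
  qed
  have "{\<kappa>. v \<kappa> \<noteq> 0} \<subseteq> (\<lambda>(\<mu>, k, l). \<mu> - e l + e k) ` (Poly_Mapping.keys f \<times> UNIV \<times> UNIV)"
  proof
    fix \<kappa> assume "\<kappa> \<in> {\<kappa>. v \<kappa> \<noteq> 0}"
    then obtain \<alpha> k l where "\<kappa> = \<alpha> + e k" "Poly_Mapping.lookup f (\<alpha> + e l) \<noteq> 0"
      using decomp by blast
    then show "\<kappa> \<in> (\<lambda>(\<mu>, k, l). \<mu> - e l + e k) ` (Poly_Mapping.keys f \<times> UNIV \<times> UNIV)"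
      by (intro image_eqI[of _ _ "(\<alpha> + e l, k, l)"]) (auto simp: in_keys_iff)
  qed
  then have "finite {\<kappa>. v \<kappa> \<noteq> 0}"
    by (rule finite_subset) simp
  then have lookup: "Poly_Mapping.lookup (Abs_poly_mapping v) = v"
    by simp
  have "Abs_poly_mapping v \<in> homog d"
    unfolding homog_iff lookup
  proof (intro allI impI)
    fix \<kappa> assume "v \<kappa> \<noteq> 0"
    then obtain \<alpha> k l where "\<kappa> = \<alpha> + e k" "Poly_Mapping.lookup f (\<alpha> + e l) \<noteq> 0"
      using decomp by blast
    then show "tdeg \<kappa> = d"
      using f by (force simp: homog_iff e_def)
  qed
  moreover have "jet (Abs_poly_mapping v) \<alpha> = A *v jet f \<alpha>" for \<alpha>
    by (simp add: vec_eq_iff jet_nth lookup v flip: e_def[unfolded One_nat_def])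
  ultimately show ?thesis by blast
qed

lemma gamma_eqI:
  assumes "d > 0" "g \<in> homog d" "\<And>\<alpha>. jet g \<alpha> = A *v jet f \<alpha>"
  shows "gamma d f A = g"
  unfolding gamma_def grad_eq_smul_mat_vec_iff
  using assms by (intro the_equality) (auto intro!: homog_eqI)

lemma gamma_Mf:
  assumes "d > 0" "f \<in> homog d" "A \<in> Mf f"
  shows gamma_homog: "gamma d f A \<in> homog d"
    and jet_gamma: "jet (gamma d f A) \<alpha> = A *v jet f \<alpha>"
  using ex_grad_eq_if_Mf[OF assms(3,2)] gamma_eqI[OF assms(1)] by metis+

text \<open>
  A row of \<open>P\<close> is a linear differential operator, and \<open>P\<close> kills the column \<open>\<partial>f\<close> exactly when all these
  operators annihilate \<open>f\<close>.  This is the form in which the hypothesis on \<open>ann f\<close> is used: a matrix is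
  determined by its action on the vectors \<open>jet f \<alpha>\<close>.
\<close>

lemma eq_0_if_annihilates_jets:
  fixes f :: "('a::field, 'n::finite) divpow"
  assumes ann: "ann f \<inter> homog 1 = {0}" and P: "\<And>\<alpha>. (P :: 'a ^ 'n ^ 'n) *v jet f \<alpha> = 0"
  shows "P = 0"
proof -
  have row: "smul_mat_vec P partials $ i = (\<Sum>j\<in>UNIV. Poly_Mapping.single (Poly_Mapping.single j 1) (P $ i $ j) :: ('a, 'n) dpoly)" for i
    by (simp add: smul_mat_vec_def partials_def smul_single)
  have "smul_mat_vec P partials $ i = (0 :: ('a, 'n) dpoly)" for i
  proof -
    have "contract (smul_mat_vec P partials $ i) f = 0"
      by (rule poly_mapping_eqI) (simp add: lookup_contract_row P)
    moreover have "smul_mat_vec P partials $ i \<in> (homog 1 :: ('a, 'n) dpoly set)"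
      unfolding row by (intro homog_sum) (simp add: homog_iff lookup_single when_def)
    ultimately show ?thesis using ann by (auto simp: ann_def)
  qed
  then have "Poly_Mapping.lookup (smul_mat_vec P partials $ i :: ('a, 'n) dpoly) (Poly_Mapping.single j 1) = 0" for i j
    by simp
  then have "(\<Sum>k\<in>UNIV. (P $ i $ k when Poly_Mapping.single k (1::nat) = Poly_Mapping.single j 1)) = 0" for i j
    by (simp add: row lookup_sum lookup_single)
  moreover have "Poly_Mapping.single k (1::nat) = Poly_Mapping.single j 1 \<longleftrightarrow> k = j" for k j :: 'n
    by (metis lookup_single_eq lookup_single_not_eq one_neq_zero)
  ultimately have "P $ i $ j = 0" for i j
    by (simp add: when_def)
  then show ?thesis by (simp add: vec_eq_iff)
qed

section \<open>Linear forms and independence\<close>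

lemma jet_contract:
  fixes g :: "('a::field, 'n::finite) divpow"
  shows "jet (contract D g) \<alpha> = (\<Sum>\<beta>\<in>Poly_Mapping.keys D. Poly_Mapping.lookup D \<beta> *s jet g (\<alpha> + \<beta>))"
  by (simp add: vec_eq_iff jet_nth lookup_contract ac_simps)

lemma contract_homog:
  assumes "D \<in> homog e" "g \<in> homog (e + k)"
  shows "contract D g \<in> homog k"
  unfolding homog_iff
proof (intro allI impI)
  fix \<alpha> assume "Poly_Mapping.lookup (contract D g) \<alpha> \<noteq> 0"
  then obtain \<beta> where "Poly_Mapping.lookup D \<beta> \<noteq> 0" "Poly_Mapping.lookup g (\<alpha> + \<beta>) \<noteq> 0"
    unfolding lookup_contract by (auto elim!: sum.not_neutral_contains_not_neutral)
  then have "tdeg \<beta> = e" "tdeg (\<alpha> + \<beta>) = e + k"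
    using assms unfolding homog_iff by blast+
  then show "tdeg \<alpha> = k" by simp
qed

lemma smul_contract: "smul c (contract D g) = contract (smul c D) g"
proof (rule poly_mapping_eqI)
  fix \<alpha>
  have "Poly_Mapping.keys (smul c D) \<subseteq> Poly_Mapping.keys D"
    by (auto simp: in_keys_iff lookup_smul)
  then show "Poly_Mapping.lookup (smul c (contract D g)) \<alpha> = Poly_Mapping.lookup (contract (smul c D) g) \<alpha>"
    by (simp add: lookup_smul lookup_contract_superset[of "Poly_Mapping.keys D"] sum_distrib_left mult.assoc)
qed

text \<open>
  A linear form \<open>p\<close> has the coordinate vector \<open>jet p 0\<close>.  Applying \<open>\<partial>^\<beta>\<close> with \<open>\<beta>\<close> of total degree \<open>e\<close> to \<open>g\<close>
  gives the linear form with coordinates \<open>jet g \<beta>\<close>, and for all other \<open>\<beta>\<close> the vector \<open>jet g \<beta>\<close> is zero.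
\<close>

lemma jet_image_deriv_space:
  fixes g :: "('a::field, 'n::finite) divpow"
  assumes g: "g \<in> homog (Suc e)"
  shows "(\<lambda>p. jet p 0) ` deriv_space e g = vec.span (range (jet g))" (is "?L = _")
proof
  show "?L \<subseteq> vec.span (range (jet g))"
    by (auto simp: deriv_space_def jet_contract intro!: vec.span_sum vec.span_scale
        vec.span_base[OF rangeI])
  have "vec.subspace ?L"
    unfolding vec.subspace_def
  proof (intro conjI ballI allI)
    show "0 \<in> ?L"
      by (intro image_eqI[of _ _ 0]) (auto simp: deriv_space_def intro!: exI[of _ 0])
    show "x + y \<in> ?L" if "x \<in> ?L" "y \<in> ?L" for x y
      using that by (auto simp: deriv_space_def simp flip: jet_add contract_add intro!: imageI homog_add)
    show "c *s x \<in> ?L" if "x \<in> ?L" for c x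
      using that by (auto simp: deriv_space_def smul_contract simp flip: jet_smul intro!: imageI homog_smul)
  qed
  moreover have "jet g \<beta> \<in> ?L" for \<beta>
  proof (cases "jet g \<beta> = 0")
    case True
    then show ?thesis using \<open>vec.subspace ?L\<close> vec.subspace_0 by auto
  next
    case False
    then have "Poly_Mapping.single \<beta> 1 \<in> homog e"
      using tdeg_if_jet_nonzero[OF g] by (auto simp: homog_iff lookup_single when_def)
    moreover have "jet g \<beta> = jet (contract (Poly_Mapping.single \<beta> 1) g) 0"
      by (simp add: jet_contract)
    ultimately show ?thesis by (auto simp: deriv_space_def)
  qed
  ultimately show "vec.span (range (jet g)) \<subseteq> ?L"
    by (intro vec.span_minimal) auto
qed

lemma deriv_space_homog: "g \<in> homog (Suc e) \<Longrightarrow> deriv_space e g \<subseteq> homog 1"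
  by (auto simp: deriv_space_def intro!: contract_homog)

lemma linear_form_eq_0_iff:
  assumes "p \<in> homog 1"
  shows "jet p 0 = 0 \<longleftrightarrow> p = 0"
proof
  assume "jet p 0 = 0"
  then have "jet p \<alpha> = jet 0 \<alpha>" for \<alpha>
    using tdeg_if_jet_nonzero[OF assms, of \<alpha>] by (cases "\<alpha> = 0") auto
  then show "p = 0"
    using assms by (intro homog_eqI[of _ 1]) auto
qed simp

text \<open>
  Trivial intersection of each member with the sum of the others is the same as uniqueness of the
  decomposition of zero; a summand moves to the other side of an equation by a change of sign.
\<close>

lemma independent_subgroups_iff:
  fixes D :: "'i \<Rightarrow> 'b::ab_group_add set"
  assumes fin: "finite I" and zero: "\<And>i. i \<in> I \<Longrightarrow> 0 \<in> D i"
    and uminus: "\<And>i x. i \<in> I \<Longrightarrow> x \<in> D i \<Longrightarrow> - x \<in> D i"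
  shows "(\<forall>i\<in>I. D i \<inter> (\<Sum>j\<in>I - {i}. D j) = {0}) \<longleftrightarrow>
    (\<forall>s. (\<forall>i\<in>I. s i \<in> D i) \<longrightarrow> sum s I = 0 \<longrightarrow> (\<forall>i\<in>I. s i = 0))" (is "?L \<longleftrightarrow> ?R")
proof
  assume L: ?L
  show ?R
  proof (intro allI impI ballI)
    fix s i assume s: "\<forall>i\<in>I. s i \<in> D i" "sum s I = 0" and i: "i \<in> I"
    have "s i = (\<Sum>j\<in>I - {i}. - s j)"
      using s(2) fin i by (simp add: sum.remove sum_negf eq_neg_iff_add_eq_0)
    then have "s i \<in> (\<Sum>j\<in>I - {i}. D j)"
      using s(1) uminus fin by (auto simp: set_sum_alt intro!: exI[of _ "\<lambda>j. - s j"])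
    then show "s i = 0"
      using L s(1) i by blast
  qed
next
  assume R: ?R
  show ?L
  proof (intro ballI equalityI subsetI)
    fix i x assume i: "i \<in> I" and x: "x \<in> D i \<inter> (\<Sum>j\<in>I - {i}. D j)"
    then obtain s where s: "x = sum s (I - {i})" "\<forall>j\<in>I - {i}. s j \<in> D j"
      using fin by (auto simp: set_sum_alt)
    have "sum (s(i := - x)) I = 0"
      using s(1) fin i by (simp add: sum.remove)
    moreover have "\<forall>j\<in>I. (s(i := - x)) j \<in> D j"
      using s(2) x i uminus by simp
    ultimately have "\<forall>j\<in>I. (s(i := - x)) j = 0"
      using R by blast
    from bspec[OF this i] show "x \<in> {0}" by simp
  next
    fix i x assume "i \<in> I" "x \<in> {0::'b}"
    then show "x \<in> D i \<inter> (\<Sum>j\<in>I - {i}. D j)"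
      using zero fin by (auto simp: set_sum_alt intro!: exI[of _ "\<lambda>_. 0"])
  qed
qed

text \<open>
  Linear forms are determined by their coordinate vectors, so the independence of the spaces
  \<open>deriv_space e (gs ! i)\<close> can be tested on the spans of the vectors \<open>jet (gs ! i) \<alpha>\<close>.
\<close>

lemma regular_splitting_iff:
  fixes f :: "('a::field, 'n::finite) divpow"
  shows "regular_splitting (Suc e) f gs \<longleftrightarrow>
    gs \<noteq> [] \<and> f = sum_list gs \<and> (\<forall>i<length gs. gs ! i \<in> homog (Suc e) \<and> gs ! i \<noteq> 0) \<and>
    (\<forall>w. (\<forall>i<length gs. w i \<in> vec.span (range (jet (gs ! i)))) \<longrightarrow>
       (\<Sum>i<length gs. w i) = 0 \<longrightarrow> (\<forall>i<length gs. w i = 0))"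
proof -
  have "(\<forall>i<length gs. deriv_space e (gs ! i) \<inter>
          (\<Sum>j\<in>{..<length gs} - {i}. deriv_space e (gs ! j)) = {0}) \<longleftrightarrow>
    (\<forall>w. (\<forall>i<length gs. w i \<in> vec.span (range (jet (gs ! i)))) \<longrightarrow>
       (\<Sum>i<length gs. w i) = 0 \<longrightarrow> (\<forall>i<length gs. w i = 0))" (is "?L \<longleftrightarrow> ?R")
    if homog: "\<forall>i<length gs. gs ! i \<in> homog (Suc e)"
  proof -
    let ?I = "{..<length gs}" and ?D = "\<lambda>i. deriv_space e (gs ! i)"
    have image: "(\<lambda>p. jet p 0) ` ?D i = vec.span (range (jet (gs ! i)))" if "i \<in> ?I" for i
      using jet_image_deriv_space homog that by blast
    have D1: "?D i \<subseteq> homog 1" if "i \<in> ?I" for i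
      using deriv_space_homog homog that by blast
    have zero: "0 \<in> ?D i" for i
      by (auto simp: deriv_space_def intro!: exI[of _ 0])
    have uminus: "- x \<in> ?D i" if "x \<in> ?D i" for x i
    proof -
      have "- x = smul (- 1) x"
        by (rule poly_mapping_eqI) (simp add: lookup_smul)
      then show ?thesis
        using that by (auto simp: deriv_space_def smul_contract intro!: homog_smul)
    qed
    have "?L \<longleftrightarrow> (\<forall>i\<in>?I. ?D i \<inter> (\<Sum>j\<in>?I - {i}. ?D j) = {0})" by auto
    also have "\<dots> \<longleftrightarrow> (\<forall>s. (\<forall>i\<in>?I. s i \<in> ?D i) \<longrightarrow> sum s ?I = 0 \<longrightarrow> (\<forall>i\<in>?I. s i = 0))"
      by (rule independent_subgroups_iff) (use uminus zero in auto)
    also have "\<dots> \<longleftrightarrow> ?R"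
    proof (intro iffI allI impI)
      fix w i
      assume indep: "\<forall>s. (\<forall>i\<in>?I. s i \<in> ?D i) \<longrightarrow> sum s ?I = 0 \<longrightarrow> (\<forall>i\<in>?I. s i = 0)"
        and w: "\<forall>i<length gs. w i \<in> vec.span (range (jet (gs ! i)))" "(\<Sum>i<length gs. w i) = 0"
        and i: "i < length gs"
      have "\<forall>i\<in>?I. \<exists>p\<in>?D i. w i = jet p 0"
        using w(1) image by blast
      then obtain s where s: "\<forall>i\<in>?I. s i \<in> ?D i \<and> w i = jet (s i) 0"
        by metis
      then have "jet (sum s ?I) 0 = 0"
        using w(2) by (simp add: jet_sum)
      moreover have "sum s ?I \<in> homog 1"
        using s D1 by (intro homog_sum) blast
      ultimately have "sum s ?I = 0"
        by (simp add: linear_form_eq_0_iff)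
      then have "s i = 0" using indep s i by blast
      then show "w i = 0" using s i by simp
    next
      fix s
      assume R: ?R and s: "\<forall>i\<in>?I. s i \<in> ?D i" "sum s ?I = 0"
      have "\<forall>i<length gs. jet (s i) 0 \<in> vec.span (range (jet (gs ! i)))"
        using s(1) image by blast
      moreover have "(\<Sum>i<length gs. jet (s i) 0) = 0"
        using s(2) by (simp flip: jet_sum)
      ultimately have "\<forall>i<length gs. jet (s i) 0 = 0"
        using R[rule_format, of "\<lambda>i. jet (s i) 0"] by blast
      then show "\<forall>i\<in>?I. s i = 0"
        using s(1) D1 linear_form_eq_0_iff by blast
    qed
    finally show ?thesis .
  qed
  then show ?thesis
    unfolding regular_splitting_def diff_Suc_1 by blast
qed

section \<open>Projections onto the summands of a direct sum\<close>

lemma matrix_vector_mult_sum_right: "A *v (\<Sum>i\<in>I. v i) = (\<Sum>i\<in>I. A *v v i)"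
  by (induction I rule: infinite_finite_induct) (auto simp: matrix_vector_right_distrib)

lemma matrix_vector_mult_sum_left: "(\<Sum>i\<in>I. A i) *v v = (\<Sum>i\<in>I. A i *v v)"
  by (induction I rule: infinite_finite_induct) (auto simp: matrix_vector_mult_add_rdistrib)

text \<open>
  Were some \<open>u\<close> outside the span, a linear map that vanishes on the span and fixes \<open>u\<close> would give a
  nonzero annihilating matrix.
\<close>

lemma span_eq_UNIV_if_no_annihilating_matrix:
  fixes S :: "('a::field ^ 'n::finite) set"
  assumes P: "\<And>P :: 'a ^ 'n ^ 'n. (\<And>v. v \<in> S \<Longrightarrow> P *v v = 0) \<Longrightarrow> P = 0"
  shows "vec.span S = UNIV"
proof (rule ccontr)
  assume "vec.span S \<noteq> UNIV"
  then obtain u where u: "u \<notin> vec.span S" by blast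
  obtain B where B: "B \<subseteq> S" "vec.independent B" "S \<subseteq> vec.span B"
    using vec.maximal_independent_subset by blast
  have "u \<notin> vec.span B"
    using u B(1) vec.span_mono by blast
  then have "vec.independent (insert u B)" "u \<notin> B"
    using B(2) vec.independent_insertI vec.span_base by blast+
  then obtain g where g: "Vector_Spaces.linear (*s) (*s) g"
    "\<forall>x\<in>insert u B. g x = (if x = u then u else 0)"
    using vec.linear_independent_extend[of "insert u B" "\<lambda>x. if x = u then u else 0"] by blast
  have "g b = 0" if "b \<in> B" for b
    using g(2) that \<open>u \<notin> B\<close> by auto
  then have "g x = 0" if "x \<in> vec.span B" for x
    using vec.linear_eq_0_on_span[OF g(1) _ that] by blast
  then have "matrix g *v v = 0" if "v \<in> S" for v
    using that B(3) by (auto simp: matrix_works[OF g(1)])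
  then have "matrix g = 0" by (rule P)
  then have "g u = 0"
    using matrix_works[OF g(1), of u] by simp
  then show False
    using g(2) u vec.span_zero by auto
qed

lemma ex_projections:
  fixes V :: "'i \<Rightarrow> ('a::field ^ 'n::finite) set"
  assumes fin: "finite I" and sub: "\<And>i. i \<in> I \<Longrightarrow> vec.subspace (V i)"
    and indep: "\<And>w i. (\<And>j. j \<in> I \<Longrightarrow> w j \<in> V j) \<Longrightarrow> sum w I = 0 \<Longrightarrow> i \<in> I \<Longrightarrow> w i = 0"
    and spanning: "vec.span (\<Union>i\<in>I. V i) = UNIV"
  shows "\<exists>E. (\<forall>i\<in>I. \<forall>v. E i *v v \<in> V i) \<and> (\<forall>v. (\<Sum>i\<in>I. E i *v v) = v) \<and>
    (\<forall>i\<in>I. \<forall>j\<in>I. \<forall>v\<in>V j. E i *v v = (if i = j then v else 0))"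
proof -
  let ?S = "{sum w I |w. \<forall>i\<in>I. w i \<in> V i}"
  have "vec.subspace ?S"
    unfolding vec.subspace_def
  proof (intro conjI ballI allI)
    show "0 \<in> ?S"
      using sub vec.subspace_0 by (fastforce intro!: exI[of _ "\<lambda>_. 0"])
    show "x + y \<in> ?S" if xy: "x \<in> ?S" "y \<in> ?S" for x y
    proof -
      obtain w u where "x = sum w I" "\<forall>i\<in>I. w i \<in> V i" "y = sum u I" "\<forall>i\<in>I. u i \<in> V i"
        using xy by blast
      then show ?thesis
        using sub by (auto intro!: exI[of _ "\<lambda>i. w i + u i"] vec.subspace_add simp: sum.distrib)
    qed
    show "c *s x \<in> ?S" if x: "x \<in> ?S" for c x
    proof -
      obtain w where "x = sum w I" "\<forall>i\<in>I. w i \<in> V i"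
        using x by blast
      then show ?thesis
        using sub by (auto intro!: exI[of _ "\<lambda>i. c *s w i"] vec.subspace_scale simp: vec.scale_sum_right)
    qed
  qed
  moreover have "(\<Union>i\<in>I. V i) \<subseteq> ?S"
  proof
    fix v assume "v \<in> (\<Union>i\<in>I. V i)"
    then obtain i where i: "i \<in> I" "v \<in> V i" by blast
    have "(\<Sum>j\<in>I. if j = i then v else 0) = v"
      using fin i(1) by simp
    moreover have "\<forall>j\<in>I. (if j = i then v else 0) \<in> V j"
      using i sub by (auto intro: vec.subspace_0)
    ultimately show "v \<in> ?S"
      by (intro CollectI exI[of _ "\<lambda>j. if j = i then v else 0"]) simp
  qed
  ultimately have "vec.span (\<Union>i\<in>I. V i) \<subseteq> ?S"
    by (intro vec.span_minimal)
  then have S: "v \<in> ?S" for v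
    unfolding spanning by auto
  have "\<forall>v. \<exists>w. (\<forall>i\<in>I. w i \<in> V i) \<and> sum w I = v"
  proof
    fix v
    show "\<exists>w. (\<forall>i\<in>I. w i \<in> V i) \<and> sum w I = v"
      using S[of v] by auto
  qed
  from choice[OF this] obtain W
    where W: "\<And>v i. i \<in> I \<Longrightarrow> W v i \<in> V i" "\<And>v. sum (W v) I = v"
    by auto
  have uniq: "w i = W v i" if "\<And>j. j \<in> I \<Longrightarrow> w j \<in> V j" "sum w I = v" "i \<in> I" for w v i
  proof -
    have "w i - W v i = 0"
      using that W sub
      by (intro indep[of "\<lambda>i. w i - W v i"]) (auto simp: sum_subtractf intro: vec.subspace_diff)
    then show ?thesis by simp
  qed
  have linear: "Vector_Spaces.linear (*s) (*s) (\<lambda>v. W v i)" if "i \<in> I" for i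
    unfolding Vector_Spaces.linear_iff
  proof (intro conjI allI vec.vector_space_axioms)
    show "W (u + v) i = W u i + W v i" for u v
      using that W sub
      by (intro uniq[of "\<lambda>i. W u i + W v i", symmetric]) (auto simp: sum.distrib intro: vec.subspace_add)
    show "W (c *s v) i = c *s W v i" for c v
      using that W sub
      by (intro uniq[of "\<lambda>i. c *s W v i", symmetric])
        (auto intro: vec.subspace_scale simp flip: vec.scale_sum_right)
  qed
  define E where "E i = matrix (\<lambda>v. W v i)" for i
  have E: "E i *v v = W v i" if "i \<in> I" for i v
    unfolding E_def using matrix_works[OF linear[OF that]] .
  have "(if i = j then v else 0) = W v i" if "i \<in> I" "j \<in> I" "v \<in> V j" for i j v
    using that sub fin
    by (intro uniq[of "\<lambda>i. if i = j then v else 0"]) (auto intro: vec.subspace_0)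
  then show ?thesis
    using W E by (intro exI[of _ E]) auto
qed

section \<open>Idempotents and regular splittings\<close>

text \<open>
  From \<open>jet g\<^sub>i \<alpha> = E\<^sub>i *v jet f \<alpha>\<close>, where \<open>g\<^sub>i\<close> is the image of the idempotent \<open>E\<^sub>i\<close>, the derivative space
  of \<open>g\<^sub>i\<close> lies in the image of \<open>E\<^sub>i\<close>.  The images of orthogonal idempotents are independent, because
  \<open>E\<^sub>i\<close> extracts the \<open>i\<close>-th summand of a sum.
\<close>

lemma regular_splitting_if_idems:
  fixes f :: "('a::field, 'n::finite) divpow"
  assumes d: "d > 0" and f: "f \<in> homog d" and ann: "ann f \<inter> homog 1 = {0}"
    and Es: "complete_orth_idems Es" "set Es \<subseteq> Mf f"
  shows "regular_splitting d f (map (gamma d f) Es)"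
proof -
  obtain e where e: "d = Suc e" using d gr0_implies_Suc by blast
  let ?g = "\<lambda>i. gamma d f (Es ! i)" and ?n = "length Es"
  have Mf: "Es ! i \<in> Mf f" if "i < ?n" for i
    using Es(2) that by auto
  note homog = gamma_homog[OF d f Mf] and jet = jet_gamma[OF d f Mf]
  have mult: "Es ! i ** Es ! j = (if i = j then Es ! i else 0)" if "i < ?n" "j < ?n" for i j
    using Es(1) that by (auto simp: complete_orth_idems_def)
  have sum1: "(\<Sum>i<?n. Es ! i) = mat 1"
    using Es(1) by (simp add: complete_orth_idems_def sum_list_sum_nth atLeast0LessThan)
  have "f = (\<Sum>i<?n. ?g i)"
  proof (rule homog_eqI[OF f _ d])
    show "(\<Sum>i<?n. ?g i) \<in> homog d" using homog by (intro homog_sum) auto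
    show "jet f \<alpha> = jet (\<Sum>i<?n. ?g i) \<alpha>" for \<alpha>
      using sum1 by (simp add: jet_sum jet flip: matrix_vector_mult_sum_left)
  qed
  then have sum: "f = sum_list (map (gamma d f) Es)"
    by (simp add: sum_list_sum_nth atLeast0LessThan)
  have nonzero: "?g i \<noteq> 0" if i: "i < ?n" for i
  proof
    assume "?g i = 0"
    then have "Es ! i = 0"
      using jet[OF i] by (intro eq_0_if_annihilates_jets[OF ann]) (metis jet_zero)
    then show False using Es(1) i by (simp add: complete_orth_idems_def)
  qed
  have image: "Es ! i *v v = v" if i: "i < ?n" and v: "v \<in> vec.span (range (jet (?g i)))" for i v
  proof -
    have "vec.subspace {v. Es ! i *v v = v}"
      by (auto simp: vec.subspace_def matrix_vector_right_distrib vec.scale)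
    moreover have "range (jet (?g i)) \<subseteq> {v. Es ! i *v v = v}"
      using i by (auto simp: jet matrix_vector_mul_assoc mult)
    ultimately show ?thesis
      using vec.span_minimal v by blast
  qed
  have "w i = 0" if w: "\<forall>i<?n. w i \<in> vec.span (range (jet (?g i)))" "(\<Sum>i<?n. w i) = 0" and i: "i < ?n" for w i
  proof -
    have "Es ! i *v w j = (if i = j then w i else 0)" if j: "j < ?n" for j
    proof -
      have "Es ! i *v w j = (Es ! i ** Es ! j) *v w j"
        using image[OF j, of "w j"] w(1) j by (simp flip: matrix_vector_mul_assoc)
      also have "\<dots> = (if i = j then w i else 0)"
        using image[OF i, of "w i"] w(1) i by (auto simp: mult[OF i j])
      finally show ?thesis .
    qed
    then have "Es ! i *v (\<Sum>j<?n. w j) = w i"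
      using i by (simp add: matrix_vector_mult_sum_right)
    then show ?thesis using w(2) by simp
  qed
  then show ?thesis
    using Es(1) sum nonzero homog unfolding e regular_splitting_iff
    by (simp add: complete_orth_idems_def)
qed

text \<open>
  The derivative spaces of the summands are independent, and they span everything: a matrix that
  kills all of them kills the vectors \<open>jet f \<alpha>\<close>, hence is zero.  The projections of the resulting direct
  sum are the idempotents, since the component of \<open>jet f \<alpha>\<close> in the \<open>i\<close>-th summand is
  \<open>jet (gs ! i) \<alpha>\<close>.
\<close>

lemma idems_if_regular_splitting:
  fixes f :: "('a::field, 'n::finite) divpow"
  assumes d: "d > 0" and ann: "ann f \<inter> homog 1 = {0}" and gs: "regular_splitting d f gs"
  shows "\<exists>Es. complete_orth_idems Es \<and> set Es \<subseteq> Mf f \<and> map (gamma d f) Es = gs"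
proof -
  obtain e where e: "d = Suc e" using d gr0_implies_Suc by blast
  let ?n = "length gs" and ?V = "\<lambda>i. vec.span (range (jet (gs ! i)))"
  have gs': "gs \<noteq> []" "f = sum_list gs" "\<And>i. i < ?n \<Longrightarrow> gs ! i \<in> homog d" "\<And>i. i < ?n \<Longrightarrow> gs ! i \<noteq> 0"
    and indep: "\<And>w i. (\<And>j. j < ?n \<Longrightarrow> w j \<in> ?V j) \<Longrightarrow> (\<Sum>i<?n. w i) = 0 \<Longrightarrow> i < ?n \<Longrightarrow> w i = 0"
    using gs unfolding e regular_splitting_iff by blast+
  have jet_f: "jet f \<alpha> = (\<Sum>i<?n. jet (gs ! i) \<alpha>)" for \<alpha>
    by (simp add: gs'(2) sum_list_sum_nth atLeast0LessThan jet_sum)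
  have "vec.span (\<Union>i<?n. ?V i) = UNIV"
  proof (rule span_eq_UNIV_if_no_annihilating_matrix)
    fix P :: "'a ^ 'n ^ 'n"
    assume P: "\<And>v. v \<in> (\<Union>i<?n. ?V i) \<Longrightarrow> P *v v = 0"
    have "P *v jet (gs ! i) \<alpha> = 0" if "i < ?n" for i \<alpha>
      using that by (intro P) (auto intro: vec.span_base)
    then have "P *v jet f \<alpha> = 0" for \<alpha>
      by (simp add: jet_f matrix_vector_mult_sum_right)
    then show "P = 0" by (rule eq_0_if_annihilates_jets[OF ann])
  qed
  with indep have "\<exists>E. (\<forall>i\<in>{..<?n}. \<forall>v. E i *v v \<in> ?V i) \<and> (\<forall>v. (\<Sum>i<?n. E i *v v) = v) \<and>
      (\<forall>i\<in>{..<?n}. \<forall>j\<in>{..<?n}. \<forall>v\<in>?V j. E i *v v = (if i = j then v else 0))"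
    by (intro ex_projections) auto
  then obtain E where E: "\<And>i v. i < ?n \<Longrightarrow> E i *v v \<in> ?V i" "\<And>v. (\<Sum>i<?n. E i *v v) = v"
    "\<And>i j v. i < ?n \<Longrightarrow> j < ?n \<Longrightarrow> v \<in> ?V j \<Longrightarrow> E i *v v = (if i = j then v else 0)"
    unfolding Ball_def lessThan_iff by blast
  have jet: "jet (gs ! i) \<alpha> = E i *v jet f \<alpha>" if i: "i < ?n" for i \<alpha>
  proof -
    have "E i *v jet f \<alpha> = (\<Sum>j<?n. if i = j then jet (gs ! j) \<alpha> else 0)"
      unfolding jet_f matrix_vector_mult_sum_right
      using E(3)[OF i _ vec.span_base[OF rangeI]] by (intro sum.cong) auto
    then show ?thesis using i by simp
  qed
  let ?Es = "map E [0..<?n]"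
  have nz: "E i \<noteq> 0" if i: "i < ?n" for i
  proof
    assume "E i = 0"
    then have "gs ! i = 0"
      using jet[OF i] gs'(3)[OF i] by (intro homog_eqI[OF _ _ d]) auto
    then show False using gs'(4)[OF i] by blast
  qed
  have mult: "E i ** E j = (if i = j then E i else 0)" if "i < ?n" "j < ?n" for i j
    using E(3)[OF that E(1)[OF that(2)]] by (simp add: matrix_eq flip: matrix_vector_mul_assoc)
  have sum1: "(\<Sum>i<?n. E i) = mat 1"
    using E(2) by (simp add: matrix_eq matrix_vector_mult_sum_left)
  have "complete_orth_idems ?Es"
    using gs'(1) nz mult sum1
    by (simp add: complete_orth_idems_def sum_list_sum_nth atLeast0LessThan)
  moreover have "set ?Es \<subseteq> Mf f"
    using Mf_if_grad_eq[OF jet] by auto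
  moreover have "map (gamma d f) ?Es = gs"
    using jet gs'(3) d by (intro nth_equalityI) (auto intro!: gamma_eqI)
  ultimately show ?thesis by blast
qed

section \<open>The algebra \<open>Mf f\<close> in degree at least three\<close>

lemma Mf_diff: "A \<in> Mf f \<Longrightarrow> B \<in> Mf f \<Longrightarrow> A - B \<in> Mf f"
  by (simp add: Mf_iff matrix_vector_mult_diff_rdistrib)

text \<open>
  Both sides equal the sum of \<open>A\<^sub>p\<^sub>l B\<^sub>q\<^sub>m\<close> times the coefficient of \<open>f\<close> at \<open>\<alpha> + e l + e m\<close>.  On the left, the
  symmetry of \<open>B\<close> first moves \<open>B\<close> from the index \<open>l\<close>, on which \<open>A\<close> acts, to the index \<open>q\<close>, so that the
  two matrices act on different indices; likewise on the right with the roles exchanged.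
\<close>

lemma Mf_swap:
  fixes f :: "('a::field, 'n::finite) divpow"
  assumes A: "A \<in> Mf f" and B: "B \<in> Mf f"
  shows "(A ** B *v jet f (\<alpha> + Poly_Mapping.single q 1)) $ p =
    (B ** A *v jet f (\<alpha> + Poly_Mapping.single p 1)) $ q"
proof -
  define e :: "'n \<Rightarrow> ('n \<Rightarrow>\<^sub>0 nat)" where "e k = Poly_Mapping.single k 1" for k
  have expand: "(A ** B *v jet f (\<alpha> + e q)) $ p =
      (\<Sum>l\<in>UNIV. \<Sum>m\<in>UNIV. A $ p $ l * (B $ q $ m * Poly_Mapping.lookup f (\<alpha> + e l + e m)))"
    if "B \<in> Mf f" for A B p q
  proof -
    have "(A ** B *v jet f (\<alpha> + e q)) $ p = (\<Sum>l\<in>UNIV. A $ p $ l * (B *v jet f (\<alpha> + e q)) $ l)"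
      unfolding matrix_vector_mul_assoc[symmetric] by (subst matrix_vector_mult_def) simp
    also have "\<dots> = (\<Sum>l\<in>UNIV. A $ p $ l * (B *v jet f (\<alpha> + e l)) $ q)"
      using that unfolding Mf_iff e_def by metis
    also have "\<dots> = (\<Sum>l\<in>UNIV. \<Sum>m\<in>UNIV. A $ p $ l * (B $ q $ m * Poly_Mapping.lookup f (\<alpha> + e l + e m)))"
      by (simp add: matrix_vector_mult_def jet_nth sum_distrib_left e_def)
    finally show ?thesis .
  qed
  show ?thesis
    unfolding e_def[symmetric] expand[OF A] expand[OF B]
    by (subst sum.swap) (simp add: ac_simps)
qed

text \<open>
  An entry of \<open>A ** B *v jet f \<alpha>\<close> with \<open>\<alpha> = \<beta> + e j + e k\<close> involves three indices.  Three exchanges by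
  \<open>Mf_swap\<close>, along different pairs of them, return the indices to their places, and as their number
  is odd they leave \<open>A\<close> and \<open>B\<close> interchanged.  Degree at least three enters because every \<open>\<alpha>\<close> with
  \<open>jet f \<alpha> \<noteq> 0\<close> is then of this form.
\<close>

lemma Mf_commute:
  fixes f :: "('a::field, 'n::finite) divpow"
  assumes d: "d \<ge> 3" and f: "f \<in> homog d" and ann: "ann f \<inter> homog 1 = {0}"
    and A: "A \<in> Mf f" and B: "B \<in> Mf f"
  shows "A ** B = B ** A"
proof -
  define e :: "'n \<Rightarrow> ('n \<Rightarrow>\<^sub>0 nat)" where "e k = Poly_Mapping.single k 1" for k
  note swap = Mf_swap[OF A B, folded e_def]
  have comm: "A ** B *v jet f (\<beta> + e j + e k) = B ** A *v jet f (\<beta> + e j + e k)" for \<beta> j k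
    unfolding vec_eq_iff
  proof
    fix i
    have "(A ** B *v jet f (\<beta> + e j + e k)) $ i = (A ** B *v jet f (\<beta> + e k + e j)) $ i"
      by (simp add: ac_simps)
    also have "\<dots> = (B ** A *v jet f (\<beta> + e k + e i)) $ j" by (rule swap)
    also have "\<dots> = (B ** A *v jet f (\<beta> + e i + e k)) $ j" by (simp add: ac_simps)
    also have "\<dots> = (A ** B *v jet f (\<beta> + e i + e j)) $ k" by (rule swap[symmetric])
    also have "\<dots> = (A ** B *v jet f (\<beta> + e j + e i)) $ k" by (simp add: ac_simps)
    also have "\<dots> = (B ** A *v jet f (\<beta> + e j + e k)) $ i" by (rule swap)
    finally show "(A ** B *v jet f (\<beta> + e j + e k)) $ i = (B ** A *v jet f (\<beta> + e j + e k)) $ i" .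
  qed
  have "(A ** B - B ** A) *v jet f \<alpha> = 0" for \<alpha>
  proof (cases "jet f \<alpha> = 0")
    case False
    then have deg: "tdeg \<alpha> \<ge> 2"
      using tdeg_if_jet_nonzero[OF f] d by fastforce
    obtain \<gamma> k where \<gamma>: "\<alpha> = \<gamma> + e k"
      using deg by (cases \<alpha> rule: exponent_cases) (auto simp: e_def)
    obtain \<beta> j where "\<gamma> = \<beta> + e j"
      using deg \<gamma> by (cases \<gamma> rule: exponent_cases) (auto simp: e_def)
    then show ?thesis
      using comm[of \<beta> j k] \<gamma> by (simp add: matrix_vector_mult_diff_rdistrib)
  qed simp
  then have "A ** B - B ** A = 0"
    by (rule eq_0_if_annihilates_jets[OF ann])
  then show ?thesis by simp
qed

text \<open>
  For commuting \<open>A\<close> and \<open>B\<close>, the exchange rule is the integrability condition for their product.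
\<close>

lemma Mf_mult:
  assumes A: "A \<in> Mf f" and B: "B \<in> Mf f" and comm: "A ** B = B ** A"
  shows "A ** B \<in> Mf f"
  unfolding Mf_iff using Mf_swap[OF A B] comm by metis

section \<open>Refinement of complete sets of orthogonal idempotents\<close>

definition complete_idem_set :: "('a::field ^ 'n ^ 'n) set \<Rightarrow> bool" where
  "complete_idem_set S \<longleftrightarrow> finite S \<and> 0 \<notin> S \<and>
     (\<forall>A\<in>S. \<forall>B\<in>S. A ** B = (if A = B then A else 0)) \<and> \<Sum>S = mat 1"

lemma mat_1_neq_0: "(mat 1 :: 'a::field ^ 'n ^ 'n) \<noteq> 0"
  by (simp add: mat_def vec_eq_iff)

text \<open>
  A list of nonzero orthogonal idempotents has no repetitions: \<open>E = E ** E = 0\<close> for a repeated entry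
  \<open>E\<close>.  So the list may be replaced by its set, which is more convenient when members are exchanged.
\<close>

lemma complete_orth_idems_iff: "complete_orth_idems Es \<longleftrightarrow> distinct Es \<and> complete_idem_set (set Es)"
proof (intro iffI conjI)
  assume Es: "complete_orth_idems Es"
  then show "distinct Es"
    unfolding complete_orth_idems_def distinct_conv_nth by metis
  then have "\<Sum>(set Es) = mat 1"
    using Es by (simp add: complete_orth_idems_def distinct_sum_list_conv_Sum)
  then show "complete_idem_set (set Es)"
    using Es unfolding complete_idem_set_def complete_orth_idems_def
    by (auto simp: in_set_conv_nth) metis
next
  assume *: "distinct Es \<and> complete_idem_set (set Es)"
  then have "sum_list Es = mat 1"
    by (simp add: complete_idem_set_def distinct_sum_list_conv_Sum)
  moreover have "Es \<noteq> []"
    using calculation mat_1_neq_0 by force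
  ultimately show "complete_orth_idems Es"
    using * unfolding complete_idem_set_def complete_orth_idems_def
    by (auto simp: nth_eq_iff_index_eq) (metis nth_mem)
qed

lemma matrix_diff_ldistrib: "A ** (B - C) = A ** B - A ** (C :: 'a::ring_1 ^ 'n ^ 'n)"
  by (simp add: matrix_eq matrix_vector_mult_diff_rdistrib matrix_vector_mult_diff_distrib flip: matrix_vector_mul_assoc)

lemma matrix_diff_rdistrib: "(B - C) ** A = B ** A - (C :: 'a::ring_1 ^ 'n ^ 'n) ** A"
  by (simp add: matrix_eq matrix_vector_mult_diff_rdistrib flip: matrix_vector_mul_assoc)

lemma matrix_mult_sum_left: "(\<Sum>i\<in>I. A i) ** B = (\<Sum>i\<in>I. A i ** (B :: 'a::ring_1 ^ 'n ^ 'n))"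
  by (simp add: matrix_eq matrix_vector_mult_sum_left flip: matrix_vector_mul_assoc)

lemma matrix_mult_sum_right: "B ** (\<Sum>i\<in>I. A i) = (\<Sum>i\<in>I. B ** (A i :: 'a::ring_1 ^ 'n ^ 'n))"
  by (simp add: matrix_eq matrix_vector_mult_sum_left matrix_vector_mult_sum_right flip: matrix_vector_mul_assoc)

text \<open>
  Nonzero fixed vectors of the members, one for each, are linearly independent: each idempotent
  isolates its own coefficient in a linear relation.
\<close>

lemma card_complete_idem_set_le:
  fixes S :: "('a::field ^ 'n ^ 'n::finite) set"
  assumes S: "complete_idem_set S"
  shows "card S \<le> CARD('n)"
proof -
  have "\<exists>w. w \<noteq> 0 \<and> E *v w = w" if "E \<in> S" for E
  proof -
    have "E \<noteq> 0" "E ** E = E" using S that by (auto simp: complete_idem_set_def)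
    then obtain v where "E *v v \<noteq> 0" by (auto simp: matrix_eq)
    then show ?thesis
      using \<open>E ** E = E\<close> by (intro exI[of _ "E *v v"]) (simp add: matrix_vector_mul_assoc)
  qed
  then obtain w where w: "\<And>E. E \<in> S \<Longrightarrow> w E \<noteq> 0" "\<And>E. E \<in> S \<Longrightarrow> E *v w E = w E"
    by metis
  have orth: "E *v w F = (if E = F then w E else 0)" if "E \<in> S" "F \<in> S" for E F
  proof -
    have "E *v w F = E ** F *v w F" using w(2) that by (simp flip: matrix_vector_mul_assoc)
    then show ?thesis using S that w(2) by (auto simp: complete_idem_set_def)
  qed
  have fin: "finite S" using S by (simp add: complete_idem_set_def)
  have inj: "inj_on w S"
    using orth w(1) by (intro inj_onI) metis
  have "vec.independent (w ` S)"
  proof (rule vec.independent_if_scalars_zero)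
    fix c x assume sum: "(\<Sum>x\<in>w ` S. c x *s x) = 0" and "x \<in> w ` S"
    then obtain E where E: "E \<in> S" "x = w E" by blast
    have "(\<Sum>F\<in>S. c (w F) *s w F) = 0"
      using sum inj by (simp add: sum.reindex)
    then have "(\<Sum>F\<in>S. E *v (c (w F) *s w F)) = 0"
      by (simp flip: matrix_vector_mult_sum_right)
    moreover have "E *v (c (w F) *s w F) = (if E = F then c (w E) *s w E else 0)" if "F \<in> S" for F
      using orth[OF E(1) that] by (simp add: vec.scale)
    ultimately have "c (w E) *s w E = 0"
      using fin E(1) by simp
    then show "c x = 0" using w(1) E by simp
  qed (use fin in simp)
  then have "card (w ` S) \<le> vec.dim (UNIV :: ('a ^ 'n) set)"
    by (intro vec.independent_card_le_dim) auto
  then show ?thesis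
    using inj by (simp add: card_image vec.dim_UNIV vec.dimension_def card_cart_basis)
qed

text \<open>
  An idempotent \<open>X\<close> properly below \<open>E\<close> refines the complete set: \<open>E\<close> is the sum of the orthogonal
  idempotents \<open>X\<close> and \<open>E - X\<close>.
\<close>

lemma complete_idem_set_split:
  assumes S: "complete_idem_set S" and E: "E \<in> S"
    and X: "X ** X = X" "E ** X = X" "X ** E = X" "X \<noteq> 0" "X \<noteq> E"
  shows "complete_idem_set (insert X (insert (E - X) (S - {E})))" (is "complete_idem_set ?T")
    and "card (insert X (insert (E - X) (S - {E}))) = Suc (card S)"
proof -
  have fin: "finite S" and orth: "\<And>A B. A \<in> S \<Longrightarrow> B \<in> S \<Longrightarrow> A ** B = (if A = B then A else 0)"
    and nz: "0 \<notin> S" and sum: "\<Sum>S = mat 1"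
    using S by (auto simp: complete_idem_set_def)
  have XB: "X ** B = 0" "B ** X = 0" if "B \<in> S - {E}" for B
    using orth[of E B] orth[of B E] E that X(2,3)
    by (metis DiffE matrix_mul_assoc singletonI times0_left times0_right)+
  have EX: "X ** (E - X) = 0" "(E - X) ** X = 0" "(E - X) ** (E - X) = E - X" "E - X \<noteq> 0"
    using X orth[OF E E] by (auto simp: matrix_diff_ldistrib matrix_diff_rdistrib)
  have EB: "(E - X) ** B = 0" "B ** (E - X) = 0" if "B \<in> S - {E}" for B
    using orth[of E B] orth[of B E] E that XB[OF that]
    by (auto simp: matrix_diff_ldistrib matrix_diff_rdistrib)
  have "X \<noteq> E - X" using EX(1) X(1,4) by metis
  moreover have "X \<notin> S - {E}" using XB X(1,4) by metis
  moreover have "E - X \<notin> S - {E}" using EB EX(3,4) by metis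
  ultimately have new: "X \<notin> insert (E - X) (S - {E})" "E - X \<notin> S - {E}" by auto
  have "\<Sum>?T = mat 1"
    using new fin sum E by (simp add: sum.remove)
  moreover have "A ** B = (if A = B then A else 0)" if "A \<in> ?T" "B \<in> ?T" for A B
    using that new XB EX EB X(1) orth by auto
  ultimately show "complete_idem_set ?T"
    using fin nz X(4) EX(4) by (auto simp: complete_idem_set_def)
  show "card ?T = Suc (card S)"
    using new fin card_Suc_Diff1[OF fin E] by simp
qed

text \<open>
  Since the \<open>Fs\<close> sum to the identity, some product \<open>Es ! i ** Fs ! j\<close> is nonzero, hence equal to
  \<open>Es ! i\<close>; orthogonality of the \<open>Fs\<close> makes this \<open>j\<close> unique, and \<open>\<sigma> i\<close> is defined to be it.  Multiplying
  the sum of the \<open>Es\<close> by \<open>Fs ! j\<close> leaves the members that are sent to \<open>j\<close>.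
\<close>

lemma grouping_of_idems:
  fixes Es Fs :: "('a::field ^ 'n ^ 'n) list"
  assumes Es: "complete_orth_idems Es" and Fs: "complete_orth_idems Fs"
    and primitive: "\<And>E F. E \<in> set Es \<Longrightarrow> F \<in> set Fs \<Longrightarrow> E ** F = 0 \<or> E ** F = E"
  shows "grouping_of Es Fs"
proof -
  let ?n = "length Es" and ?m = "length Fs"
  have sums: "(\<Sum>i<?n. Es ! i) = mat 1" "(\<Sum>j<?m. Fs ! j) = mat 1"
    using Es Fs by (simp_all add: complete_orth_idems_def sum_list_sum_nth atLeast0LessThan)
  have "\<exists>j<?m. Es ! i ** Fs ! j \<noteq> 0" if i: "i < ?n" for i
  proof (rule ccontr)
    assume "\<not> ?thesis"
    then have "Es ! i ** (\<Sum>j<?m. Fs ! j) = 0"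
      by (simp add: matrix_mult_sum_right)
    then show False
      using Es i by (simp add: sums complete_orth_idems_def)
  qed
  then obtain \<sigma> where \<sigma>: "\<And>i. i < ?n \<Longrightarrow> \<sigma> i < ?m" "\<And>i. i < ?n \<Longrightarrow> Es ! i ** Fs ! \<sigma> i \<noteq> 0"
    by metis
  have mult: "Es ! i ** Fs ! j = (if \<sigma> i = j then Es ! i else 0)" if i: "i < ?n" and j: "j < ?m" for i j
  proof -
    have eq: "Es ! i ** Fs ! \<sigma> i = Es ! i"
      using primitive[of "Es ! i" "Fs ! \<sigma> i"] \<sigma>[OF i] i by auto
    show ?thesis
    proof (cases "\<sigma> i = j")
      case False
      then have "Fs ! \<sigma> i ** Fs ! j = 0"
        using Fs \<sigma>(1)[OF i] j by (simp add: complete_orth_idems_def)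
      then have "(Es ! i ** Fs ! \<sigma> i) ** Fs ! j = 0"
        by (simp flip: matrix_mul_assoc)
      then show ?thesis using eq False by simp
    qed (use eq in simp)
  qed
  have Fsum: "Fs ! j = (\<Sum>i | i < ?n \<and> \<sigma> i = j. Es ! i)" if j: "j < ?m" for j
  proof -
    have "Fs ! j = (\<Sum>i<?n. Es ! i) ** Fs ! j"
      by (simp add: sums)
    also have "\<dots> = (\<Sum>i<?n. if \<sigma> i = j then Es ! i else 0)"
      unfolding matrix_mult_sum_left using mult j by (intro sum.cong) auto
    also have "\<dots> = (\<Sum>i | i < ?n \<and> \<sigma> i = j. Es ! i)"
      by (simp add: sum.inter_filter[symmetric])
    finally show ?thesis .
  qed
  have "\<exists>i<?n. \<sigma> i = j" if j: "j < ?m" for j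
  proof (rule ccontr)
    assume "\<not> ?thesis"
    then have empty: "{i. i < ?n \<and> \<sigma> i = j} = {}" by blast
    have "Fs ! j = 0" unfolding Fsum[OF j] empty by simp
    then show False using Fs j by (simp add: complete_orth_idems_def)
  qed
  then have "\<sigma> ` {..<?n} = {..<?m}"
    using \<sigma>(1) by fastforce
  then show ?thesis
    unfolding grouping_of_def using Fsum by blast
qed

text \<open>
  Otherwise \<open>E ** F\<close> would be an idempotent properly below \<open>E\<close>, and splitting \<open>E\<close> would give a larger
  complete set.
\<close>

lemma idem_mult_eq_0_or_self_if_maximal:
  fixes M :: "('a::field ^ 'n ^ 'n) set"
  assumes mult: "\<And>A B. A \<in> M \<Longrightarrow> B \<in> M \<Longrightarrow> A ** B \<in> M"
    and comm: "\<And>A B. A \<in> M \<Longrightarrow> B \<in> M \<Longrightarrow> A ** B = B ** A"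
    and diff: "\<And>A B. A \<in> M \<Longrightarrow> B \<in> M \<Longrightarrow> A - B \<in> M"
    and S: "complete_idem_set S" "S \<subseteq> M"
    and max: "\<And>T. complete_idem_set T \<Longrightarrow> T \<subseteq> M \<Longrightarrow> card T \<le> card S"
    and E: "E \<in> S" and F: "F \<in> M" "F ** F = F"
  shows "E ** F = 0 \<or> E ** F = E"
proof (rule ccontr)
  assume proper: "\<not> ?thesis"
  have EM: "E \<in> M" and EE: "E ** E = E"
    using E S by (auto simp: complete_idem_set_def)
  have X1: "E ** (E ** F) = E ** F"
    by (simp add: matrix_mul_assoc EE)
  have X2: "(E ** F) ** E = E ** F"
    using X1 comm[OF EM mult[OF EM F(1)]] by simp
  have "(E ** F) ** (E ** F) = ((E ** F) ** E) ** F"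
    by (simp add: matrix_mul_assoc)
  also have "\<dots> = E ** F"
    unfolding X2 by (simp add: F(2) flip: matrix_mul_assoc)
  finally have X3: "(E ** F) ** (E ** F) = E ** F" .
  let ?T = "insert (E ** F) (insert (E - E ** F) (S - {E}))"
  have "complete_idem_set ?T" "card ?T = Suc (card S)"
    using complete_idem_set_split[OF S(1) E X3 X1 X2] proper by auto
  moreover have "?T \<subseteq> M"
    using S(2) EM F(1) mult diff by auto
  ultimately show False
    using max[of ?T] by simp
qed

lemma gamma_sum:
  assumes d: "d > 0" and f: "f \<in> homog d" and A: "\<And>i. i \<in> I \<Longrightarrow> A i \<in> Mf f"
  shows "gamma d f (\<Sum>i\<in>I. A i) = (\<Sum>i\<in>I. gamma d f (A i))"
  using gamma_homog[OF d f A] jet_gamma[OF d f A]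
  by (intro gamma_eqI[OF d] homog_sum) (auto simp: jet_sum matrix_vector_mult_sum_left)

lemma grouping_of_map_gamma:
  assumes d: "d > 0" and f: "f \<in> homog d" and Es: "set Es \<subseteq> Mf f" and grouping: "grouping_of Es Fs"
  shows "grouping_of (map (gamma d f) Es) (map (gamma d f) Fs)"
proof -
  obtain \<sigma> where \<sigma>: "\<sigma> ` {..<length Es} = {..<length Fs}"
    "\<And>j. j < length Fs \<Longrightarrow> Fs ! j = (\<Sum>i | i < length Es \<and> \<sigma> i = j. Es ! i)"
    using grouping unfolding grouping_of_def by blast
  have "gamma d f (Fs ! j) = (\<Sum>i | i < length Es \<and> \<sigma> i = j. map (gamma d f) Es ! i)"
    if "j < length Fs" for j
    unfolding \<sigma>(2)[OF that] using Es by (subst gamma_sum[OF d f]) auto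
  then show ?thesis
    unfolding grouping_of_def using \<sigma>(1) by (intro exI[of _ \<sigma>]) simp
qed

theorem theorem3p7:
  fixes f :: "('a::field, 'n::finite) divpow" and d :: nat
  assumes "d \<ge> 2" and "f \<in> homog d" and "ann f \<inter> homog 1 = {0}"
  shows "bij_betw (\<lambda>S. gamma d f ` S) (Coid (Mf f)) (Reg d f) \<and>
    (\<forall>Es. complete_orth_idems Es \<and> set Es \<subseteq> Mf f \<longrightarrow>
        regular_splitting d f (map (gamma d f) Es)) \<and>
    (d \<ge> 3 \<longrightarrow>
      (\<exists>gs. regular_splitting d f gs \<and>
        (\<forall>hs. regular_splitting d f hs \<longrightarrow> length hs \<le> length gs) \<and>
        (\<forall>hs. regular_splitting d f hs \<and> length hs = length gs \<longrightarrow> mset hs = mset gs) \<and>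
        (\<forall>hs. regular_splitting d f hs \<longrightarrow> grouping_of gs hs)))"
proof (intro conjI allI impI)
  have d: "d > 0" using assms(1) by simp
  note f = assms(2) and ann = assms(3)
  have split: "regular_splitting d f (map (gamma d f) Es)"
    if "complete_orth_idems Es" "set Es \<subseteq> Mf f" for Es
    using regular_splitting_if_idems[OF d f ann that] .
  have idems: "\<exists>Es. complete_orth_idems Es \<and> set Es \<subseteq> Mf f \<and> gs = map (gamma d f) Es"
    if "regular_splitting d f gs" for gs
    using idems_if_regular_splitting[OF d ann that] by metis
  show "regular_splitting d f (map (gamma d f) Es)"
    if "complete_orth_idems Es \<and> set Es \<subseteq> Mf f" for Es
    using split that by blast
  have "inj_on (gamma d f) (Mf f)"
  proof (rule inj_onI)
    fix A B assume AB: "A \<in> Mf f" "B \<in> Mf f" "gamma d f A = gamma d f B"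
    have "(A - B) *v jet f \<alpha> = 0" for \<alpha>
      using jet_gamma[OF d f AB(1), of \<alpha>] jet_gamma[OF d f AB(2), of \<alpha>] AB(3)
      by (simp add: matrix_vector_mult_diff_rdistrib)
    then have "A - B = 0" by (rule eq_0_if_annihilates_jets[OF ann])
    then show "A = B" by simp
  qed
  then have "inj_on (image (gamma d f)) (Pow (Mf f))"
    by (rule inj_on_image_Pow)
  then have "inj_on (image (gamma d f)) (Coid (Mf f))"
    by (rule inj_on_subset) (auto simp: Coid_def)
  moreover have "image (gamma d f) ` Coid (Mf f) = Reg d f"
  proof (intro equalityI subsetI)
    fix G assume "G \<in> image (gamma d f) ` Coid (Mf f)"
    then obtain Es where "complete_orth_idems Es" "set Es \<subseteq> Mf f" "G = gamma d f ` set Es"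
      by (auto simp: Coid_def)
    then show "G \<in> Reg d f"
      using split[of Es] unfolding Reg_def by (intro CollectI exI[of _ "map (gamma d f) Es"]) simp
  next
    fix G assume "G \<in> Reg d f"
    then obtain gs where "regular_splitting d f gs" "G = set gs"
      by (auto simp: Reg_def)
    then obtain Es where "complete_orth_idems Es" "set Es \<subseteq> Mf f" "G = gamma d f ` set Es"
      using idems[of gs] by auto
    then show "G \<in> image (gamma d f) ` Coid (Mf f)"
      unfolding Coid_def by blast
  qed
  ultimately show "bij_betw (\<lambda>S. gamma d f ` S) (Coid (Mf f)) (Reg d f)"
    by (simp add: bij_betw_def)
  assume d3: "d \<ge> 3"
  note comm = Mf_commute[OF d3 f ann]
  note mult = Mf_mult[OF _ _ comm]
  let ?C = "\<lambda>S. complete_idem_set S \<and> S \<subseteq> Mf f"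
  have one: "?C {mat 1}"
    by (simp add: complete_idem_set_def mat_1_neq_0[symmetric] Mf_if_grad_eq[of f])
  have "\<exists>S. ?C S \<and> (\<forall>T. ?C T \<longrightarrow> card T \<le> card S)"
    using one card_complete_idem_set_le
    by (intro ex_has_greatest_nat[of ?C "{mat 1}" card "Suc CARD('n)"]) (auto simp: less_Suc_eq_le)
  then obtain S where S: "complete_idem_set S" "S \<subseteq> Mf f"
    and max: "\<And>T. complete_idem_set T \<Longrightarrow> T \<subseteq> Mf f \<Longrightarrow> card T \<le> card S"
    by blast
  \<comment> \<open>Stated for every complete set of maximal size, since uniqueness compares two of them.\<close>
  have prim: "E ** F = 0 \<or> E ** F = E"
    if "complete_idem_set T" "T \<subseteq> Mf f" "card S \<le> card T" "E \<in> T" "F \<in> Mf f" "F ** F = F" for T E F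
    using max that(3) by (intro idem_mult_eq_0_or_self_if_maximal[OF mult comm Mf_diff that(1,2) _ that(4-6)])
      (auto intro: order_trans)
  have idem: "F ** F = F" if "complete_idem_set T" "F \<in> T" for T F
    using that by (auto simp: complete_idem_set_def)
  have "finite S" using S(1) by (simp add: complete_idem_set_def)
  then obtain Es where Es: "set Es = S" "distinct Es"
    using finite_distinct_list by blast
  have Es_coid: "complete_orth_idems Es"
    using Es S(1) by (simp add: complete_orth_idems_iff)
  have card: "card S = length Es"
    using Es distinct_card by metis
  show "\<exists>gs. regular_splitting d f gs \<and>
        (\<forall>hs. regular_splitting d f hs \<longrightarrow> length hs \<le> length gs) \<and>
        (\<forall>hs. regular_splitting d f hs \<and> length hs = length gs \<longrightarrow> mset hs = mset gs) \<and>
        (\<forall>hs. regular_splitting d f hs \<longrightarrow> grouping_of gs hs)"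
  proof (intro exI conjI allI impI)
    show "regular_splitting d f (map (gamma d f) Es)"
      using Es_coid Es(1) S(2) by (intro split) auto
  next
    fix hs assume "regular_splitting d f hs"
    then obtain Fs where Fs: "complete_orth_idems Fs" "set Fs \<subseteq> Mf f" and hs: "hs = map (gamma d f) Fs"
      using idems by blast
    then have Fs': "distinct Fs" "complete_idem_set (set Fs)"
      by (simp_all add: complete_orth_idems_iff)
    have "length Fs \<le> length Es"
      using max[OF Fs'(2) Fs(2)] distinct_card[OF Fs'(1)] card by simp
    then show "length hs \<le> length (map (gamma d f) Es)"
      by (simp add: hs)
    have "E ** F = 0 \<or> E ** F = E" if "E \<in> set Es" "F \<in> set Fs" for E F
      using that Es(1) Fs(2) idem[OF Fs'(2)] by (intro prim[OF S]) auto
    then have "grouping_of Es Fs"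
      by (rule grouping_of_idems[OF Es_coid Fs(1)])
    then show "grouping_of (map (gamma d f) Es) hs"
      unfolding hs using Es(1) S(2) by (intro grouping_of_map_gamma[OF d f]) auto
  next
    fix hs assume "regular_splitting d f hs \<and> length hs = length (map (gamma d f) Es)"
    then obtain Fs where Fs: "complete_orth_idems Fs" "set Fs \<subseteq> Mf f" and hs: "hs = map (gamma d f) Fs"
      and length: "length Fs = length Es"
      using idems by fastforce
    then have Fs': "distinct Fs" "complete_idem_set (set Fs)"
      by (simp_all add: complete_orth_idems_iff)
    have cardF: "card (set Fs) = card S"
      using distinct_card[OF Fs'(1)] length card by simp
    \<comment> \<open>Members of two sets of maximal size with nonzero product satisfy \<open>E = E ** F = F ** E = F\<close>.\<close>
    have "S \<subseteq> set Fs"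
    proof
      fix E assume E: "E \<in> S"
      have "E \<noteq> 0" using E S(1) by (auto simp: complete_idem_set_def)
      moreover have "(\<Sum>F\<in>set Fs. E ** F) = E"
        using Fs'(2) by (simp add: complete_idem_set_def flip: matrix_mult_sum_right)
      ultimately obtain F where F: "F \<in> set Fs" "E ** F \<noteq> 0"
        by (metis sum.neutral)
      have EM: "E \<in> Mf f" and FM: "F \<in> Mf f" using E S(2) F(1) Fs(2) by auto
      have "E ** F = E"
        using prim[OF S _ E FM idem[OF Fs'(2) F(1)]] F(2) by simp
      moreover have "F ** E = F"
        using prim[OF Fs'(2) Fs(2) _ F(1) EM idem[OF S(1) E]] F(2) cardF comm[OF EM FM] by simp
      ultimately show "E \<in> set Fs" using comm[OF EM FM] F(1) by simp
    qed
    then have "set Es = set Fs"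
      using card_subset_eq[of "set Fs" S] cardF Es(1) by simp
    then have "mset Fs = mset Es"
      using set_eq_iff_mset_eq_distinct[OF Es(2) Fs'(1)] by simp
    then show "mset hs = mset (map (gamma d f) Es)"
      by (simp add: hs)
  qed
qed

end
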